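(* (Substitution Theorem) Let $G\in\mathbb{GS}$, let $A$ be a Left option of $G$ and let $B=\langle\emptyset^\ell\mid B^{\mathcal R}\rangle$ be a left-atomic Right option of $A$ with $B\preccurlyeq G$ (so $A$ is atomic-reversible through $B$). Suppose that $\underline{Ls}(G)=\underline{Rs}(A)>\underline{Rs}(G^L)$ for all $G^L\in G^{\mathcal L}\setminus\{A\}$. (1) There exists a smallest nonnegative integer $n$ such that $G\succcurlyeq\ell-\widehat n$, and for this $n$, $G\sim\langle\ell-\widehat{n+1},\,G^{\mathcal L}\setminus\{A\}\mid G^{\mathcal R}\rangle$. (2) If $A$ is the only Left option of $G$ and $\langle\emptyset^\ell\mid G^{\mathcal R}\rangle\in\mathbb{GS}$, then $G\sim\langle\emptyset^\ell\mid G^{\mathcal R}\rangle$.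
   Context: A scoring game is written $G=\langle G^{\mathcal L}\mid G^{\mathcal R}\rangle$, where each of $G^{\mathcal L}$ (Left options) and $G^{\mathcal R}$ (Right options) is either a finite nonempty set of scoring games or an atom $\emptyset^{s}$, $s\in\mathbb R$ (the player to move on that side cannot move and the game ends with score $s$); game trees are finite. An atom occurring in $G$ is an atom of $G$ or of any follower of $G$. $G$ is guaranteed if for every follower $K$ of $G$: if $K^{\mathcal L}=\emptyset^\ell$ then $\ell\le s$ for every atom $\emptyset^s$ occurring in $K$, and if $K^{\mathcal R}=\emptyset^r$ then $s\le r$ for every atom $\emptyset^s$ occurring in $K$; $\mathbb{GS}$ is the class of guaranteed games. Disjunctive sum $G+H$: Left options are $G^L+H$ and $G+H^L$, except if both are left-atomic with atoms $\emptyset^{\ell_1},\emptyset^{\ell_2}$, then $(G+H)^{\mathcal L}=\emptyset^{\ell_1+\ell_2}$; Right symmetric. Stops: $Ls(G)=\ell$ if $G^{\mathcal L}=\emptyset^\ell$, otherwise $\max_{G^L}Rs(G^L)$; $Rs(G)=r$ if $G^{\mathcal R}=\emptyset^r$, otherwise $\min_{G^R}Ls(G^R)$. $G\succcurlyeq H$ iff $Ls(G+X)\ge Ls(H+X)$ and $Rs(G+X)\ge Rs(H+X)$ for all $X\in\mathbb{GS}$; $B\preccurlyeq G$ means $G\succcurlyeq B$; $G\sim H$ iff both hold. A real number $x$ denotes $\langle\emptyset^x\mid\emptyset^x\rangle$. Conjugate: $\overleftrightarrow{G}=\langle\overleftrightarrow{G^{\mathcal R}}\mid\overleftrightarrow{G^{\mathcal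 L}}\rangle$ (atom $\emptyset^s$ becomes $\emptyset^{-s}$). Waiting moves: $\widehat 0=\langle\emptyset^0\mid\emptyset^0\rangle$, $\widehat{k+1}=\langle\widehat k\mid\emptyset^0\rangle$, $-\widehat k=\overleftrightarrow{\widehat k}$; $\ell-\widehat k$ is the disjunctive sum of $\ell$ and $-\widehat k$. Right-pass-allowed stops: $\underline{Ls}(G)=\min_{k\ge0}Ls(G-\widehat k)$, $\underline{Rs}(G)=\min_{k\ge0}Rs(G-\widehat k)$. *)

theory Defs
  imports Complex_Main "HOL-Library.FSet"
begin

(* Nonemptiness of the option sets is not part of the type; it is imposed
   hereditarily by scoring_game below. *)
datatype 'a side = Atom real | Opts "'a fset"

datatype game = Game (lside: "game side") (rside: "game side")

abbreviation left_opts :: "game \<Rightarrow> game set" where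
  "left_opts G \<equiv> set_side (lside G)"

abbreviation right_opts :: "game \<Rightarrow> game set" where
  "right_opts G \<equiv> set_side (rside G)"

lemma left_option_size: "H \<in> left_opts G \<Longrightarrow> size H < size G"
proof (cases G)
  case (Game L R)
  assume "H \<in> left_opts G"
  then obtain gs where gs: "L = Opts gs" "H \<in> fset gs" using Game by (cases L) auto
  then have "Suc (size H) \<le> (\<Sum>x\<in>fset gs. Suc (size x))"
    using member_le_sum[of H "fset gs" "\<lambda>x. Suc (size x)"] by simp
  then show ?thesis using Game gs by simp
qed

lemma right_option_size: "H \<in> right_opts G \<Longrightarrow> size H < size G"
proof (cases G)
  case (Game L R)
  assume "H \<in> right_opts G"
  then obtain gs where gs: "R = Opts gs" "H \<in> fset gs" using Game by (cases R) auto
  then have "Suc (size H) \<le> (\<Sum>x\<in>fset gs. Suc (size x))"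
    using member_le_sum[of H "fset gs" "\<lambda>x. Suc (size x)"] by simp
  then show ?thesis using Game gs by simp
qed

lemma Opts_size:
  "\<lbrakk>lside G = Opts gs; H |\<in>| gs\<rbrakk> \<Longrightarrow> size H < size G"
  "\<lbrakk>rside G = Opts gs; H |\<in>| gs\<rbrakk> \<Longrightarrow> size H < size G"
  using left_option_size[of H G] right_option_size[of H G] by auto

(* The followers of G include G itself. *)
inductive_set followers :: "game \<Rightarrow> game set" for G :: game where
  self: "G \<in> followers G"
| left: "\<lbrakk>K \<in> followers G; H \<in> left_opts K\<rbrakk> \<Longrightarrow> H \<in> followers G"
| right: "\<lbrakk>K \<in> followers G; H \<in> right_opts K\<rbrakk> \<Longrightarrow> H \<in> followers G"

definition atoms :: "game \<Rightarrow> real set" where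
  "atoms G = {s. \<exists>K\<in>followers G. lside K = Atom s \<or> rside K = Atom s}"

definition scoring_game :: "game \<Rightarrow> bool" where
  "scoring_game G \<longleftrightarrow>
     (\<forall>K\<in>followers G. lside K \<noteq> Opts {||} \<and> rside K \<noteq> Opts {||})"

definition GS :: "game set" where
  "GS = {G. scoring_game G \<and>
     (\<forall>K\<in>followers G.
        (\<forall>l. lside K = Atom l \<longrightarrow> (\<forall>s\<in>atoms K. l \<le> s)) \<and>
        (\<forall>r. rside K = Atom r \<longrightarrow> (\<forall>s\<in>atoms K. s \<le> r)))}"

function gsum :: "game \<Rightarrow> game \<Rightarrow> game" (infixl "\<oplus>" 65) where
  "G \<oplus> H = Game
     (case lside G of
        Atom a \<Rightarrow> (case lside H of
            Atom b \<Rightarrow> Atom (a + b)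
          | Opts hs \<Rightarrow> Opts ((\<lambda>h. G \<oplus> h) |`| hs))
      | Opts gs \<Rightarrow> (case lside H of
            Atom b \<Rightarrow> Opts ((\<lambda>g. g \<oplus> H) |`| gs)
          | Opts hs \<Rightarrow> Opts ((\<lambda>g. g \<oplus> H) |`| gs |\<union>| (\<lambda>h. G \<oplus> h) |`| hs)))
     (case rside G of
        Atom a \<Rightarrow> (case rside H of
            Atom b \<Rightarrow> Atom (a + b)
          | Opts hs \<Rightarrow> Opts ((\<lambda>h. G \<oplus> h) |`| hs))
      | Opts gs \<Rightarrow> (case rside H of
            Atom b \<Rightarrow> Opts ((\<lambda>g. g \<oplus> H) |`| gs)
          | Opts hs \<Rightarrow> Opts ((\<lambda>g. g \<oplus> H) |`| gs |\<union>| (\<lambda>h. G \<oplus> h) |`| hs)))"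
  by pat_completeness auto
termination
  by (relation "measure (\<lambda>(G, H). size G + size H)") (auto dest: Opts_size)

declare gsum.simps [simp del]

function Ls :: "game \<Rightarrow> real" and Rs :: "game \<Rightarrow> real" where
  "Ls G = (case lside G of Atom l \<Rightarrow> l | Opts gs \<Rightarrow> Max (Rs ` fset gs))"
| "Rs G = (case rside G of Atom r \<Rightarrow> r | Opts gs \<Rightarrow> Min (Ls ` fset gs))"
  by pat_completeness auto
termination
  by (relation "measure (case_sum size size)") (auto dest: Opts_size)

declare Ls.simps [simp del] Rs.simps [simp del]

definition game_ge :: "game \<Rightarrow> game \<Rightarrow> bool" (infix "\<succeq>" 50) where
  "G \<succeq> H \<longleftrightarrow> (\<forall>X\<in>GS. Ls (G \<oplus> X) \<ge> Ls (H \<oplus> X) \<and> Rs (G \<oplus> X) \<ge> Rs (H \<oplus> X))"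

abbreviation game_le :: "game \<Rightarrow> game \<Rightarrow> bool" (infix "\<preceq>" 50) where
  "H \<preceq> G \<equiv> G \<succeq> H"

definition game_equiv :: "game \<Rightarrow> game \<Rightarrow> bool" (infix "\<sim>" 50) where
  "G \<sim> H \<longleftrightarrow> G \<succeq> H \<and> H \<succeq> G"

definition number :: "real \<Rightarrow> game" where
  "number x = Game (Atom x) (Atom x)"

primrec negate_atom :: "'a side \<Rightarrow> 'a side" where
  "negate_atom (Atom s) = Atom (- s)"
| "negate_atom (Opts gs) = Opts gs"

primrec conjugate :: "game \<Rightarrow> game" where
  "conjugate (Game L R) =
     Game (negate_atom (map_side conjugate R)) (negate_atom (map_side conjugate L))"

primrec waiting :: "nat \<Rightarrow> game" where
  "waiting 0 = Game (Atom 0) (Atom 0)"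
| "waiting (Suc k) = Game (Opts {|waiting k|}) (Atom 0)"

definition sub_waiting :: "game \<Rightarrow> nat \<Rightarrow> game" where
  "sub_waiting G k = G \<oplus> conjugate (waiting k)"

(* Min is a genuine minimum here: for every scoring game G the values
   Ls (sub_waiting G k) and Rs (sub_waiting G k) lie in the finite set atoms G;
   see finite_range_stops below. *)
definition Ls_pass :: "game \<Rightarrow> real" where
  "Ls_pass G = Min (range (\<lambda>k. Ls (sub_waiting G k)))"

definition Rs_pass :: "game \<Rightarrow> real" where
  "Rs_pass G = Min (range (\<lambda>k. Rs (sub_waiting G k)))"

lemma followers_trans: "\<lbrakk>H \<in> followers K; K \<in> followers G\<rbrakk> \<Longrightarrow> H \<in> followers G"
  by (induction rule: followers.induct) (auto intro: followers.intros)

lemma option_follower: "H \<in> left_opts G \<union> right_opts G \<Longrightarrow> H \<in> followers G"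
  using followers.left[OF followers.self] followers.right[OF followers.self] by blast

lemma atoms_option:
  "H \<in> left_opts G \<union> right_opts G \<Longrightarrow> atoms H \<subseteq> atoms G"
  unfolding atoms_def using option_follower[of H G] followers_trans by blast

lemma scoring_game_option:
  "\<lbrakk>scoring_game G; H \<in> left_opts G \<union> right_opts G\<rbrakk> \<Longrightarrow> scoring_game H"
  unfolding scoring_game_def using option_follower[of H G] followers_trans by blast

lemma followers_unfold:
  "followers G = insert G (\<Union>H\<in>left_opts G \<union> right_opts G. followers H)"
proof (intro equalityI subsetI)
  fix K assume "K \<in> followers G"
  then show "K \<in> insert G (\<Union>H\<in>left_opts G \<union> right_opts G. followers H)"
  proof induction
    case self
    show ?case by blast
  next
    case (left K H)
    then show ?case using followers.self[of H] followers.left[of K _ H] by blast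
  next
    case (right K H)
    then show ?case using followers.self[of H] followers.right[of K _ H] by blast
  qed
next
  fix K assume "K \<in> insert G (\<Union>H\<in>left_opts G \<union> right_opts G. followers H)"
  then consider "K = G" | H where "H \<in> left_opts G \<union> right_opts G" "K \<in> followers H"
    by blast
  then show "K \<in> followers G"
    using followers.self followers_trans[OF _ option_follower] by cases simp_all
qed

lemma finite_set_side: "finite (set_side S)"
  by (cases S) auto

lemma finite_followers: "finite (followers G)"
proof (induction "size G" arbitrary: G rule: less_induct)
  case less
  then show ?case
    by (subst followers_unfold)
       (auto simp: finite_set_side dest: left_option_size right_option_size)
qed

lemma finite_atoms: "finite (atoms G)"
proof (rule finite_subset)
  let ?f = "\<lambda>S :: game side. case S of Atom s \<Rightarrow> s | Opts _ \<Rightarrow> 0"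
  show "atoms G \<subseteq> (?f \<circ> lside) ` followers G \<union> (?f \<circ> rside) ` followers G"
    by (force simp: atoms_def image_iff)
qed (simp add: finite_followers)

lemma conjugate_waiting:
  "lside (conjugate (waiting k)) = Atom 0"
  "rside (conjugate (waiting k)) =
     (case k of 0 \<Rightarrow> Atom 0 | Suc j \<Rightarrow> Opts {|conjugate (waiting j)|})"
  by (cases k; simp)+

lemma sides_sub_waiting:
  "lside (sub_waiting G k) =
     (case lside G of Atom s \<Rightarrow> Atom s | Opts gs \<Rightarrow> Opts ((\<lambda>g. sub_waiting g k) |`| gs))"
  "rside (sub_waiting G 0) =
     (case rside G of Atom s \<Rightarrow> Atom s | Opts gs \<Rightarrow> Opts ((\<lambda>g. sub_waiting g 0) |`| gs))"
  "rside (sub_waiting G (Suc j)) =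
     (case rside G of
        Atom s \<Rightarrow> Opts {|sub_waiting G j|}
      | Opts gs \<Rightarrow> Opts ((\<lambda>g. sub_waiting g (Suc j)) |`| gs |\<union>| {|sub_waiting G j|}))"
  unfolding sub_waiting_def
  by (subst gsum.simps, simp add: conjugate_waiting del: waiting.simps split: side.split)+

lemma stops_sub_waiting_atoms:
  assumes "scoring_game G"
  shows "Ls (sub_waiting G k) \<in> atoms G \<and> Rs (sub_waiting G k) \<in> atoms G"
  using assms
proof (induction "size G + k" arbitrary: G k rule: less_induct)
  case less
  have ne: "lside G \<noteq> Opts {||}" "rside G \<noteq> Opts {||}"
    using less.prems followers.self[of G] by (auto simp: scoring_game_def)
  have L: "Rs (sub_waiting H k) \<in> atoms G" if "H \<in> left_opts G" for H
    using less.hyps[of H k] that left_option_size[OF that] atoms_option[of H G]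
      scoring_game_option[OF less.prems, of H] by auto
  have R: "Ls (sub_waiting H k) \<in> atoms G" if "H \<in> right_opts G" for H
    using less.hyps[of H k] that right_option_size[OF that] atoms_option[of H G]
      scoring_game_option[OF less.prems, of H] by auto
  have W: "Ls (sub_waiting G j) \<in> atoms G" if "k = Suc j" for j
    using less.hyps[of G j] that less.prems by auto
  have "Ls (sub_waiting G k) \<in> atoms G"
  proof (cases "lside G")
    case (Atom s)
    then show ?thesis
      using followers.self[of G]
      by (auto simp: Ls.simps[of "sub_waiting G k"] sides_sub_waiting atoms_def)
  next
    case (Opts gs)
    let ?S = "(\<lambda>H. Rs (sub_waiting H k)) ` fset gs"
    have "Ls (sub_waiting G k) = Max ?S"
      using Opts
      by (simp add: Ls.simps[of "sub_waiting G k"] sides_sub_waiting image_image)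
    moreover have "Max ?S \<in> ?S" using Opts ne by (intro Max_in) auto
    ultimately show ?thesis using L Opts by auto
  qed
  moreover have "Rs (sub_waiting G k) \<in> atoms G"
  proof (cases "rside G")
    case (Atom s)
    then show ?thesis
      using followers.self[of G] W
      by (cases k)
         (auto simp: Rs.simps[of "sub_waiting G _"] sides_sub_waiting atoms_def)
  next
    case (Opts gs)
    let ?S = "(\<lambda>H. Ls (sub_waiting H k)) ` fset gs
                \<union> (case k of 0 \<Rightarrow> {} | Suc j \<Rightarrow> {Ls (sub_waiting G j)})"
    have "Rs (sub_waiting G k) = Min ?S"
      using Opts
      by (cases k)
         (simp_all add: Rs.simps[of "sub_waiting G _"] sides_sub_waiting image_image image_Un)
    moreover have "Min ?S \<in> ?S" using Opts ne by (intro Min_in) (auto split: nat.split)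
    ultimately show ?thesis using R W Opts by (auto split: nat.splits)
  qed
  ultimately show ?case ..
qed

lemma finite_range_stops:
  assumes "scoring_game G"
  shows "finite (range (\<lambda>k. Ls (sub_waiting G k)))" "finite (range (\<lambda>k. Rs (sub_waiting G k)))"
  by (rule finite_subset[OF _ finite_atoms[of G]];
      use stops_sub_waiting_atoms[OF assms] in blast)+

end

theory Submission
  imports Defs
begin

text \<open>
  Two games with the same Right side are compared by induction on the test game \<open>X\<close>, where only
  Left's move has to be examined. Left's move to \<open>A + X\<close> is answered by \<open>B + X\<close>. There Left either
  has no move, which gives \<open>l\<close> plus the atom of \<open>X\<close>, or moves in \<open>X\<close>; since \<open>B \<preceq> G\<close> the latter is no
  better than making the same move in \<open>G + X\<close>. If \<open>X\<close> is left-atomic, guaranteedness bounds all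
  its atoms below by the left one, so \<open>l\<close> minus any number of waiting moves also yields at least
  \<open>l\<close> plus that atom. Conversely, Left's new move to \<open>l\<close> minus \<open>n + 1\<close> waiting moves can be answered
  by a waiting move, which yields a position dominated by \<open>G + X\<close>. Such an \<open>n\<close> exists because every
  atom of \<open>B\<close> is at least \<open>l\<close>, so that with enough waiting moves Right can match any play in \<open>B\<close>.
\<close>

section \<open>Guaranteed games and their options\<close>

lemma scoring_game_sides:
  assumes "scoring_game G"
  shows "lside G \<noteq> Opts {||}" "rside G \<noteq> Opts {||}"
  using assms followers.self[of G] by (auto simp: scoring_game_def)

lemma GS_scoring_game: "G \<in> GS \<Longrightarrow> scoring_game G"
  by (simp add: GS_def)

lemma GS_option: "\<lbrakk>G \<in> GS; H \<in> left_opts G \<union> right_opts G\<rbrakk> \<Longrightarrow> H \<in> GS"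
  using scoring_game_option[of G H] followers_trans[OF _ option_follower[of H G]]
  by (fastforce simp: GS_def)

lemma GS_lside_Atom_le: "\<lbrakk>G \<in> GS; lside G = Atom l; s \<in> atoms G\<rbrakk> \<Longrightarrow> l \<le> s"
  using followers.self[of G] unfolding GS_def by blast

lemma GS_rside_Atom_ge: "\<lbrakk>G \<in> GS; rside G = Atom r; s \<in> atoms G\<rbrakk> \<Longrightarrow> s \<le> r"
  using followers.self[of G] unfolding GS_def by blast

lemma side_in_atoms:
  "lside G = Atom s \<Longrightarrow> s \<in> atoms G" "rside G = Atom s \<Longrightarrow> s \<in> atoms G"
  using followers.self[of G] by (auto simp: atoms_def)

section \<open>Moves and stops of disjunctive sums\<close>

lemma left_opts_gsum:
  "left_opts (G \<oplus> H) = (\<lambda>g. g \<oplus> H) ` left_opts G \<union> (\<lambda>h. G \<oplus> h) ` left_opts H"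
  by (subst gsum.simps) (auto split: side.split)

lemma right_opts_gsum:
  "right_opts (G \<oplus> H) = (\<lambda>g. g \<oplus> H) ` right_opts G \<union> (\<lambda>h. G \<oplus> h) ` right_opts H"
  by (subst gsum.simps) (auto split: side.split)

lemma Rs_le_Ls_left_option: "H \<in> left_opts G \<Longrightarrow> Rs H \<le> Ls G"
  by (cases "lside G") (auto simp: Ls.simps[of G])

lemma Rs_le_Ls_right_option: "H \<in> right_opts G \<Longrightarrow> Rs G \<le> Ls H"
  by (cases "rside G") (auto simp: Rs.simps[of G])

lemma Rs_gsum_le_Ls_gsum:
  "g \<in> left_opts G \<Longrightarrow> Rs (g \<oplus> H) \<le> Ls (G \<oplus> H)"
  "h \<in> left_opts H \<Longrightarrow> Rs (G \<oplus> h) \<le> Ls (G \<oplus> H)"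
  "g \<in> right_opts G \<Longrightarrow> Rs (G \<oplus> H) \<le> Ls (g \<oplus> H)"
  "h \<in> right_opts H \<Longrightarrow> Rs (G \<oplus> H) \<le> Ls (G \<oplus> h)"
  by (auto intro: Rs_le_Ls_left_option Rs_le_Ls_right_option
      simp: left_opts_gsum right_opts_gsum)

lemma Ls_option:
  assumes "lside G = Opts gs" "gs \<noteq> {||}"
  shows "\<exists>g\<in>left_opts G. Ls G = Rs g"
proof -
  have "Max (Rs ` fset gs) \<in> Rs ` fset gs" using assms by (intro Max_in) auto
  then show ?thesis using assms by (auto simp: Ls.simps[of G])
qed

lemma Rs_option:
  assumes "rside G = Opts gs" "gs \<noteq> {||}"
  shows "\<exists>g\<in>right_opts G. Rs G = Ls g"
proof -
  have "Min (Ls ` fset gs) \<in> Ls ` fset gs" using assms by (intro Min_in) auto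
  then show ?thesis using assms by (auto simp: Rs.simps[of G])
qed

lemma Ls_gsum_Atom: "\<lbrakk>lside G = Atom a; lside H = Atom b\<rbrakk> \<Longrightarrow> Ls (G \<oplus> H) = a + b"
  by (subst Ls.simps, subst gsum.simps) simp

lemma Rs_gsum_Atom: "\<lbrakk>rside G = Atom a; rside H = Atom b\<rbrakk> \<Longrightarrow> Rs (G \<oplus> H) = a + b"
  by (subst Rs.simps, subst gsum.simps) simp

text \<open>\<open>Left\<close> and \<open>Right\<close> name the summand in which the move is made,
  not the player. Nonempty sides ensure that the maximum is attained by some move.\<close>

lemma Ls_gsum_cases:
  assumes "lside G \<noteq> Opts {||}" "lside H \<noteq> Opts {||}"
  obtains (Atoms) a b where "lside G = Atom a" "lside H = Atom b" "Ls (G \<oplus> H) = a + b"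
    | (Left) g where "g \<in> left_opts G" "Ls (G \<oplus> H) = Rs (g \<oplus> H)"
    | (Right) h where "h \<in> left_opts H" "Ls (G \<oplus> H) = Rs (G \<oplus> h)"
proof (cases "\<exists>a b. lside G = Atom a \<and> lside H = Atom b")
  case True
  then show ?thesis using Atoms Ls_gsum_Atom by blast
next
  case False
  then have "\<exists>gs. lside (G \<oplus> H) = Opts gs \<and> gs \<noteq> {||}"
    using assms by (subst gsum.simps) (auto split: side.split)
  then obtain k where "k \<in> left_opts (G \<oplus> H)" "Ls (G \<oplus> H) = Rs k"
    using Ls_option by blast
  then show ?thesis using Left Right unfolding left_opts_gsum by blast
qed

lemma Rs_gsum_cases:
  assumes "rside G \<noteq> Opts {||}" "rside H \<noteq> Opts {||}"
  obtains (Atoms) a b where "rside G = Atom a" "rside H = Atom b" "Rs (G \<oplus> H) = a + b"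
    | (Left) g where "g \<in> right_opts G" "Rs (G \<oplus> H) = Ls (g \<oplus> H)"
    | (Right) h where "h \<in> right_opts H" "Rs (G \<oplus> H) = Ls (G \<oplus> h)"
proof (cases "\<exists>a b. rside G = Atom a \<and> rside H = Atom b")
  case True
  then show ?thesis using Atoms Rs_gsum_Atom by blast
next
  case False
  then have "\<exists>gs. rside (G \<oplus> H) = Opts gs \<and> gs \<noteq> {||}"
    using assms by (subst gsum.simps) (auto split: side.split)
  then obtain k where "k \<in> right_opts (G \<oplus> H)" "Rs (G \<oplus> H) = Ls k"
    using Rs_option by blast
  then show ?thesis using Left Right unfolding right_opts_gsum by blast
qed

text \<open>The player to move in a sum is stuck only when both summands are atomic on that side, so
  every play ends with one atom from each. This turns bounds on atoms into bounds on stops.\<close>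

lemma stops_gsum_atoms:
  assumes "scoring_game G" "scoring_game H"
  shows "(\<exists>a\<in>atoms G. \<exists>b\<in>atoms H. Ls (G \<oplus> H) = a + b)
       \<and> (\<exists>a\<in>atoms G. \<exists>b\<in>atoms H. Rs (G \<oplus> H) = a + b)"
  using assms
proof (induction "size G + size H" arbitrary: G H rule: less_induct)
  case less
  note ne = scoring_game_sides[OF less.prems(1)] scoring_game_sides[OF less.prems(2)]
  let ?P = "\<lambda>r. \<exists>a\<in>atoms G. \<exists>b\<in>atoms H. r = a + b"
  have G: "?P (Ls (g \<oplus> H)) \<and> ?P (Rs (g \<oplus> H))" if "g \<in> left_opts G \<union> right_opts G" for g
  proof -
    have "size g < size G" using that left_option_size right_option_size by blast
    then show ?thesis
      using less.hyps[of g H] scoring_game_option[OF less.prems(1) that] less.prems(2)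
        atoms_option[OF that] by (meson add_less_cancel_right subsetD)
  qed
  have H: "?P (Ls (G \<oplus> h)) \<and> ?P (Rs (G \<oplus> h))" if "h \<in> left_opts H \<union> right_opts H" for h
  proof -
    have "size h < size H" using that left_option_size right_option_size by blast
    then show ?thesis
      using less.hyps[of G h] scoring_game_option[OF less.prems(2) that] less.prems(1)
        atoms_option[OF that] by (meson add_less_cancel_left subsetD)
  qed
  have "?P (Ls (G \<oplus> H))"
    using ne(1,3)
  proof (cases rule: Ls_gsum_cases)
    case (Atoms a b)
    then show ?thesis using side_in_atoms(1) by blast
  next
    case (Left g)
    then show ?thesis using G[of g] by simp
  next
    case (Right h)
    then show ?thesis using H[of h] by simp
  qed
  moreover have "?P (Rs (G \<oplus> H))"
    using ne(2,4)
  proof (cases rule: Rs_gsum_cases)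
    case (Atoms a b)
    then show ?thesis using side_in_atoms(2) by blast
  next
    case (Left g)
    then show ?thesis using G[of g] by simp
  next
    case (Right h)
    then show ?thesis using H[of h] by simp
  qed
  ultimately show ?case ..
qed

lemma stops_gsum_lower:
  assumes "scoring_game G" "scoring_game H" "\<forall>s\<in>atoms G. a \<le> s" "\<forall>s\<in>atoms H. b \<le> s"
  shows "a + b \<le> Ls (G \<oplus> H)" "a + b \<le> Rs (G \<oplus> H)"
  using stops_gsum_atoms[OF assms(1,2)] assms(3,4) by (metis add_mono)+

lemma Rs_gsum_upper:
  assumes "scoring_game G" "scoring_game H" "\<forall>s\<in>atoms G. s \<le> a" "\<forall>s\<in>atoms H. s \<le> b"
  shows "Rs (G \<oplus> H) \<le> a + b"
  using stops_gsum_atoms[OF assms(1,2)] assms(3,4) by (metis add_mono)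

section \<open>Numbers minus waiting moves\<close>

lemma sides_number_sub_waiting:
  "lside (sub_waiting (number l) n) = Atom l"
  "rside (sub_waiting (number l) 0) = Atom l"
  "rside (sub_waiting (number l) (Suc n)) = Opts {|sub_waiting (number l) n|}"
  by (simp_all add: sides_sub_waiting number_def)

text \<open>Waiting moves change only whose turn it is, so \<open>l\<close> stays the only
  score.\<close>

lemma number_sub_waiting:
  "scoring_game (sub_waiting (number l) n) \<and> atoms (sub_waiting (number l) n) = {l}"
proof (induction n)
  case 0
  show ?case
    by (simp add: scoring_game_def atoms_def followers_unfold[of "sub_waiting _ 0"]
        sides_number_sub_waiting)
next
  case (Suc n)
  then show ?case
    by (auto simp: scoring_game_def atoms_def followers_unfold[of "sub_waiting _ (Suc _)"]
        sides_number_sub_waiting)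
qed

section \<open>Comparison of games, and replacement of an atomic-reversible option\<close>

lemma game_ge_trans: "\<lbrakk>G \<succeq> H; H \<succeq> K\<rbrakk> \<Longrightarrow> G \<succeq> K"
  unfolding game_ge_def by (meson order_trans)

text \<open>Each Right move in \<open>K\<close> is matched by one waiting move and decreases the
  size, so \<open>size K\<close> waiting moves are enough. The induction lets \<open>n\<close> vary
  because each match spends one.\<close>

lemma game_ge_number_sub_waiting:
  assumes "scoring_game K" "\<forall>s\<in>atoms K. l \<le> s" "size K \<le> n"
  shows "K \<succeq> sub_waiting (number l) n"
proof -
  have "Ls (sub_waiting (number l) n \<oplus> X) \<le> Ls (K \<oplus> X)
      \<and> Rs (sub_waiting (number l) n \<oplus> X) \<le> Rs (K \<oplus> X)" if "X \<in> GS" for X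
    using that assms
  proof (induction "size K + size X" arbitrary: K X n rule: less_induct)
    case less
    let ?W = "sub_waiting (number l)"
    have X: "scoring_game X" using less.prems(1) by (rule GS_scoring_game)
    note ne = scoring_game_sides[OF less.prems(2)] scoring_game_sides[OF X]
    have W: "scoring_game (?W n)" "atoms (?W n) = {l}" using number_sub_waiting by auto
    have L: "Ls (?W n \<oplus> X) \<le> Ls (K \<oplus> X)"
      using scoring_game_sides(1)[OF W(1)] ne(3)
    proof (cases rule: Ls_gsum_cases)
      \<comment> \<open>Here \<open>X\<close> is left-atomic, and guaranteedness makes
        \<open>b\<close> a lower bound for all its atoms, so no stop of \<open>K \<oplus> X\<close>
        lies below \<open>l + b\<close>.\<close>
      case (Atoms a b)
      then show ?thesis
        using stops_gsum_lower(1)[OF less.prems(2) X less.prems(3), of b]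
          GS_lside_Atom_le[OF less.prems(1)] by (simp add: sides_number_sub_waiting)
    next
      case (Left g)
      then show ?thesis by (simp add: sides_number_sub_waiting)
    next
      case (Right h)
      have "Rs (?W n \<oplus> h) \<le> Rs (K \<oplus> h)"
        using less.hyps[of K h n] Right(1) left_option_size[OF Right(1)] less.prems
          GS_option[of X h] by auto
      then show ?thesis using Right Rs_gsum_le_Ls_gsum(2)[of h X K] by simp
    qed
    have R: "Rs (?W n \<oplus> X) \<le> Rs (K \<oplus> X)"
      using ne(2,4)
    proof (cases rule: Rs_gsum_cases)
      \<comment> \<open>Right may still have waiting moves in \<open>?W n\<close>, so its stop is
        only bounded: the summands contribute \<open>l\<close> and at most \<open>b\<close>, while
        \<open>a\<close> is at least \<open>l\<close>.\<close>
      case (Atoms a b)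
      then have "Rs (?W n \<oplus> X) \<le> l + b"
        using Rs_gsum_upper[OF W(1) X] W(2) GS_rside_Atom_ge[OF less.prems(1)] by simp
      then show ?thesis using Atoms side_in_atoms(2)[of K a] less.prems(3) by fastforce
    next
      case (Left g)
      \<comment> \<open>\<open>K\<close> is larger than its option \<open>g\<close>, so
        \<open>n\<close> is positive; the matching waiting move leaves \<open>m\<close>, which is
        still at least \<open>size g\<close>.\<close>
      then obtain m where m: "n = Suc m"
        using right_option_size[of g K] less.prems(4) by (cases n) auto
      have "Ls (?W m \<oplus> X) \<le> Ls (g \<oplus> X)"
        using less.hyps[of g X m] right_option_size[OF Left(1)] less.prems m Left(1)
          atoms_option[of g K] scoring_game_option[of K g] by auto
      moreover have "Rs (?W n \<oplus> X) \<le> Ls (?W m \<oplus> X)"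
        by (rule Rs_gsum_le_Ls_gsum(3)) (simp add: m sides_number_sub_waiting)
      ultimately show ?thesis using Left by simp
    next
      case (Right h)
      have "Ls (?W n \<oplus> h) \<le> Ls (K \<oplus> h)"
        using less.hyps[of K h n] Right(1) right_option_size[OF Right(1)] less.prems
          GS_option[of X h] by auto
      then show ?thesis using Right Rs_gsum_le_Ls_gsum(4)[of h X "?W n"] by simp
    qed
    show ?case using L R ..
  qed
  then show ?thesis by (simp add: game_ge_def)
qed

text \<open>Right's moves in the two games agree, and moves in the test game fall under induction.
  What remains is Left's stop, where \<open>step\<close> may use the induction hypothesis for Left's
  moves in \<open>X\<close>.\<close>

lemma game_ge_same_rside:
  assumes side: "rside G = rside H" "rside G \<noteq> Opts {||}"
    and step: "\<And>X. \<lbrakk>X \<in> GS; \<And>Y. Y \<in> left_opts X \<Longrightarrow> Rs (H \<oplus> Y) \<le> Rs (G \<oplus> Y)\<rbrakk>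
        \<Longrightarrow> Ls (H \<oplus> X) \<le> Ls (G \<oplus> X)"
  shows "G \<succeq> H"
proof -
  have "Ls (H \<oplus> X) \<le> Ls (G \<oplus> X) \<and> Rs (H \<oplus> X) \<le> Rs (G \<oplus> X)" if "X \<in> GS" for X
    using that
  proof (induction "size X" arbitrary: X rule: less_induct)
    case less
    have L: "Ls (H \<oplus> X) \<le> Ls (G \<oplus> X)"
      using step[OF less.prems] less.hyps left_option_size GS_option[OF less.prems] by blast
    have "Rs (H \<oplus> X) \<le> Rs (G \<oplus> X)"
      using side(2) scoring_game_sides(2)[OF GS_scoring_game[OF less.prems]]
    proof (cases rule: Rs_gsum_cases)
      case (Atoms a b)
      then show ?thesis using Rs_gsum_Atom[of H a X b] side by simp
    next
      case (Left g)
      then show ?thesis using Rs_gsum_le_Ls_gsum(3)[of g H X] side by simp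
    next
      case (Right h)
      then show ?thesis
        using Rs_gsum_le_Ls_gsum(4)[of h X H] less.hyps[of h] right_option_size[of h X]
          GS_option[OF less.prems, of h] by auto
    qed
    then show ?case using L by simp
  qed
  then show ?thesis by (simp add: game_ge_def)
qed

text \<open>Right's reply from \<open>A\<close> to \<open>B\<close> bounds the Right stop by
  \<open>Ls (B \<oplus> X)\<close>, where Left moves in \<open>X\<close> or is stuck.
  \<open>G'\<close> stands for either replacement of \<open>G\<close>; the two secure
  \<open>l + x\<close> for a stuck Left in different ways, hence the condition
  \<open>atom\<close>.\<close>

lemma Rs_atomic_reversible_le:
  assumes "B \<in> right_opts A" "lside B = Atom l" "B \<preceq> G" "X \<in> GS"
    and "\<And>Y. Y \<in> left_opts X \<Longrightarrow> Rs (G \<oplus> Y) \<le> Rs (G' \<oplus> Y)"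
    and atom: "\<And>x. lside X = Atom x \<Longrightarrow> l + x \<le> Ls (G' \<oplus> X)"
  shows "Rs (A \<oplus> X) \<le> Ls (G' \<oplus> X)"
proof -
  have "lside B \<noteq> Opts {||}" using assms(2) by simp
  then have "Ls (B \<oplus> X) \<le> Ls (G' \<oplus> X)"
    using scoring_game_sides(1)[OF GS_scoring_game[OF assms(4)]]
  proof (cases rule: Ls_gsum_cases)
    case (Atoms a b)
    then show ?thesis using atom assms(2) by simp
  next
    case (Left g)
    then show ?thesis using assms(2) by simp
  next
    case (Right h)
    \<comment> \<open>\<open>B \<preceq> G\<close> is applied with the option \<open>h\<close> as
      test game; the induction hypothesis then passes from \<open>G\<close> to
      \<open>G'\<close>.\<close>
    then have "Rs (B \<oplus> h) \<le> Rs (G \<oplus> h)"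
      using assms(3) GS_option[OF assms(4), of h] by (auto simp: game_ge_def)
    then show ?thesis using Right assms(5)[of h] Rs_gsum_le_Ls_gsum(2)[of h X G'] by simp
  qed
  then show ?thesis using Rs_gsum_le_Ls_gsum(3)[OF assms(1), of X] by linarith
qed

text \<open>The extra waiting move in \<open>n + 1\<close> accounts for Right's reply to the new
  option: it leaves \<open>n\<close> of them, a position that \<open>G\<close> dominates.\<close>

lemma substitute_atomic_reversible:
  assumes G: "G \<in> GS" "lside G = Opts GL"
    and B: "B \<in> right_opts A" "lside B = Atom l" "B \<preceq> G"
    and n: "G \<succeq> sub_waiting (number l) n"
  shows "G \<sim> Game (Opts (finsert (sub_waiting (number l) (n + 1)) (GL |-| {|A|}))) (rside G)"
    (is "_ \<sim> ?H")
proof -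
  let ?W = "sub_waiting (number l)"
  note ne = scoring_game_sides[OF GS_scoring_game[OF G(1)]]
  have "G \<succeq> ?H"
  proof (rule game_ge_same_rside)
    fix X assume X: "X \<in> GS" and IH: "\<And>Y. Y \<in> left_opts X \<Longrightarrow> Rs (?H \<oplus> Y) \<le> Rs (G \<oplus> Y)"
    have "lside ?H \<noteq> Opts {||}" by simp
    then show "Ls (?H \<oplus> X) \<le> Ls (G \<oplus> X)"
      using scoring_game_sides(1)[OF GS_scoring_game[OF X]]
    proof (cases rule: Ls_gsum_cases)
      case (Atoms a b)
      then show ?thesis by simp
    next
      case (Left g)
      show ?thesis
      proof (cases "g = ?W (n + 1)")
        case True
        have "Rs (g \<oplus> X) \<le> Ls (?W n \<oplus> X)"
          by (rule Rs_gsum_le_Ls_gsum(3)) (simp add: True sides_number_sub_waiting)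
        also have "\<dots> \<le> Ls (G \<oplus> X)" using n X by (simp add: game_ge_def)
        finally show ?thesis using Left by simp
      next
        case False
        then show ?thesis using Left G(2) Rs_gsum_le_Ls_gsum(1)[of g G X] by simp
      qed
    next
      case (Right h)
      then show ?thesis using IH[of h] Rs_gsum_le_Ls_gsum(2)[of h X G] by simp
    qed
  qed (use ne in simp_all)
  moreover have "?H \<succeq> G"
  proof (rule game_ge_same_rside)
    fix X assume X: "X \<in> GS" and IH: "\<And>Y. Y \<in> left_opts X \<Longrightarrow> Rs (G \<oplus> Y) \<le> Rs (?H \<oplus> Y)"
    show "Ls (G \<oplus> X) \<le> Ls (?H \<oplus> X)"
      using ne(1) scoring_game_sides(1)[OF GS_scoring_game[OF X]]
    proof (cases rule: Ls_gsum_cases)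
      case (Atoms a b)
      then show ?thesis using G(2) by simp
    next
      case (Left g)
      show ?thesis
      proof (cases "g = A")
        case True
        \<comment> \<open>Left's move to \<open>?W (n + 1)\<close> stands in for the one to
          \<open>A\<close>: its only atom is \<open>l\<close>, and no atom of \<open>X\<close> lies
          below \<open>x\<close>.\<close>
        have "l + x \<le> Ls (?H \<oplus> X)" if "lside X = Atom x" for x
        proof -
          have "l + x \<le> Rs (?W (n + 1) \<oplus> X)"
            using stops_gsum_lower(2) GS_scoring_game[OF X] GS_lside_Atom_le[OF X that]
              number_sub_waiting[of l "n + 1"] by simp
          also have "\<dots> \<le> Ls (?H \<oplus> X)" by (rule Rs_gsum_le_Ls_gsum(1)) simp
          finally show ?thesis .
        qed
        then show ?thesis using Rs_atomic_reversible_le[OF B X IH] Left True by simp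
      next
        case False
        then show ?thesis using Left G(2) Rs_gsum_le_Ls_gsum(1)[of g ?H X] by simp
      qed
    next
      case (Right h)
      then show ?thesis using IH[of h] Rs_gsum_le_Ls_gsum(2)[of h X ?H] by simp
    qed
  qed (use ne in simp_all)
  ultimately show ?thesis by (simp add: game_equiv_def)
qed

text \<open>Once \<open>A\<close> is answered by \<open>B\<close>, all that Left gains beyond moves
  in \<open>X\<close> is the atom \<open>l\<close>; when \<open>A\<close> is the only Left option,
  this atom can serve as the whole Left side.\<close>

lemma substitute_only_atomic_reversible:
  assumes G: "G \<in> GS" "lside G = Opts {|A|}"
    and B: "B \<in> right_opts A" "lside B = Atom l" "B \<preceq> G"
  shows "G \<sim> Game (Atom l) (rside G)" (is "_ \<sim> ?H")
proof -
  note ne = scoring_game_sides[OF GS_scoring_game[OF G(1)]]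
  have "G \<succeq> ?H"
  proof (rule game_ge_same_rside)
    fix X assume X: "X \<in> GS" and IH: "\<And>Y. Y \<in> left_opts X \<Longrightarrow> Rs (?H \<oplus> Y) \<le> Rs (G \<oplus> Y)"
    have "lside ?H \<noteq> Opts {||}" by simp
    then show "Ls (?H \<oplus> X) \<le> Ls (G \<oplus> X)"
      using scoring_game_sides(1)[OF GS_scoring_game[OF X]]
    proof (cases rule: Ls_gsum_cases)
      case (Atoms a b)
      \<comment> \<open>\<open>?H\<close> and \<open>B\<close> have the same left atom, so a
        left-atomic \<open>X\<close> cannot tell their Left stops apart, and \<open>G\<close>
        dominates \<open>B\<close>.\<close>
      then have "Ls (?H \<oplus> X) = Ls (B \<oplus> X)" using Ls_gsum_Atom[OF B(2), of X b] by simp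
      then show ?thesis using B(3) X by (simp add: game_ge_def)
    next
      case (Left g)
      then show ?thesis by simp
    next
      case (Right h)
      then show ?thesis using IH[of h] Rs_gsum_le_Ls_gsum(2)[of h X G] by simp
    qed
  qed (use ne in simp_all)
  moreover have "?H \<succeq> G"
  proof (rule game_ge_same_rside)
    fix X assume X: "X \<in> GS" and IH: "\<And>Y. Y \<in> left_opts X \<Longrightarrow> Rs (G \<oplus> Y) \<le> Rs (?H \<oplus> Y)"
    show "Ls (G \<oplus> X) \<le> Ls (?H \<oplus> X)"
      using ne(1) scoring_game_sides(1)[OF GS_scoring_game[OF X]]
    proof (cases rule: Ls_gsum_cases)
      case (Atoms a b)
      then show ?thesis using G(2) by simp
    next
      case (Left g)
      \<comment> \<open>For this \<open>?H\<close> the atom condition holds with equality.\<close>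
      then show ?thesis
        using Rs_atomic_reversible_le[OF B X IH] Ls_gsum_Atom[of ?H l X] G(2) by simp
    next
      case (Right h)
      then show ?thesis using IH[of h] Rs_gsum_le_Ls_gsum(2)[of h X ?H] by simp
    qed
  qed (use ne in simp_all)
  ultimately show ?thesis by (simp add: game_equiv_def)
qed

theorem theorem33:
  fixes G A B :: game and GL :: "game fset" and l :: real
  assumes "G \<in> GS"
    and "lside G = Opts GL" and "A |\<in>| GL"
    and "B \<in> right_opts A" and "lside B = Atom l"
    and "B \<preceq> G"
    and "Ls_pass G = Rs_pass A"
    and "\<forall>C. C |\<in>| GL |-| {|A|} \<longrightarrow> Rs_pass A > Rs_pass C"
  shows "(\<exists>n. G \<succeq> sub_waiting (number l) n
            \<and> (\<forall>m. G \<succeq> sub_waiting (number l) m \<longrightarrow> n \<le> m)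
            \<and> G \<sim> Game (Opts (finsert (sub_waiting (number l) (n + 1)) (GL |-| {|A|}))) (rside G))
       \<and> (GL = {|A|} \<and> Game (Atom l) (rside G) \<in> GS
            \<longrightarrow> G \<sim> Game (Atom l) (rside G))"
proof -
  \<comment> \<open>As a follower of \<open>G\<close>, \<open>B\<close> is guaranteed, so its left
    atom \<open>l\<close> bounds its atoms from below. Hence \<open>size B\<close> waiting moves are
    enough for \<open>B\<close>, and by transitivity for \<open>G\<close>, and a least
    \<open>n\<close> exists.\<close>
  have "B \<in> GS" using GS_option[of G A] GS_option[of A B] assms(1-4) by simp
  then have "B \<succeq> sub_waiting (number l) (size B)"
    using GS_lside_Atom_le[OF _ assms(5)]
    by (intro game_ge_number_sub_waiting) (auto intro: GS_scoring_game)
  then have ex: "G \<succeq> sub_waiting (number l) (size B)" using game_ge_trans assms(6) by blast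
  define n where "n = (LEAST n. G \<succeq> sub_waiting (number l) n)"
  have "G \<succeq> sub_waiting (number l) n" unfolding n_def using ex by (rule LeastI)
  moreover have "n \<le> m" if "G \<succeq> sub_waiting (number l) m" for m
    unfolding n_def using that by (rule Least_le)
  ultimately show ?thesis
    using substitute_atomic_reversible[OF assms(1,2,4,5,6)]
      substitute_only_atomic_reversible[OF assms(1) _ assms(4,5,6)] assms(2) by blast
qed

end
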